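(* Let $F$ be a field with a Krull valuation $v:F\to\Gamma\cup\{\infty\}$ onto an ordered abelian group $\Gamma$, and let $C\subseteq F$ be a lift of the residue field. Suppose $(f,\alpha)\mapsto f|_{\alpha}:F\times\Gamma\to F$ and $\gamma\mapsto\tau^\gamma:\Gamma\to F^\times$ form a truncation structure on $F$ (i.e. satisfy (T1)–(T8) below). Then there is a unique embedding $e:F\to C((t^\Gamma))$ such that $e(\tau^\gamma)=t^\gamma$ for all $\gamma\in\Gamma$, the image $e(F)$ is truncation closed, and $e$ induces the given truncation structure, i.e. $e(f|_\alpha)=e(f)|_\alpha$ for all $f\in F$, $\alpha\in\Gamma$.
   Context: $\Gamma$ is an additively written ordered abelian group with total translation-invariant order; $v:F\to\Gamma\cup\{\infty\}$ is a (Krull) valuation with valuation ring $\mathcal O=\{f: vf\ge0\}$. A lift of the residue field is a subfield $C\subseteq\mathcal O$ mapped bijectively onto the residue field by the residue map. The Hahn field $C((t^\Gamma))$ consists of formal sums $f=\sum_\gamma c_\gamma t^\gamma$ ($c_\gamma\in C$) with wellordered support $\operatorname{supp} f=\{\gamma: c_\gamma\neq0\}$; $v_t(f)=\min\operatorname{supp} f$ for $f\ne0$, $v_t(0)=\infty$; the $\alpha$-truncation is $f|_\alpha=\sum_{\gamma<\alpha}c_\gamma t^\gamma$. A subset $S$ of $C((t^\Gamma))$ is truncation closed if $f|_\alpha\in S$ for all $f\in S$, $\alpha\in\Gamma$. An embedding $e:F\to C((t^\Gamma))$ is a field embedding that is the identity on $C$ and satisfies $v_t(e(f))=v(f)$ for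 all $f\in F$. For $f\in F$ put $\operatorname{sp}(f)=\{\gamma\in\Gamma: v(f-f|_\gamma)=\gamma\}$. A truncation structure on $F$ is a pair of maps $(f,\alpha)\mapsto f|_\alpha:F\times\Gamma\to F$ and $\gamma\mapsto\tau^\gamma:\Gamma\to F^\times$ such that for all $f,g\in F$, $c\in C$, $\alpha,\beta,\gamma\in\Gamma$: (T1) $v(f-f|_\alpha)\ge\alpha$; (T2) $v(f)\ge\alpha\Rightarrow f|_\alpha=0$; (T3) $\beta>\alpha\Rightarrow (f|_\alpha)|_\beta=f|_\alpha$; (T4) $(f+g)|_\alpha=f|_\alpha+g|_\alpha$ and $(cf)|_\alpha=c\cdot(f|_\alpha)$; (T5) $\operatorname{sp}(f)$ is wellordered; (T6) if $\operatorname{sp}(f)+\operatorname{sp}(g)<\gamma$ (i.e. $a+b<\gamma$ for all $a\in\operatorname{sp}(f)$, $b\in\operatorname{sp}(g)$) then $\operatorname{sp}(fg)<\gamma$; (T7) $\tau^{\alpha+\beta}=\tau^\alpha\tau^\beta$; (T8) $\operatorname{sp}(\tau^\gamma)=\{\gamma\}$. *)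

theory Defs
  imports Complex_Main
begin

section \<open>Value groups with infinity and Krull valuations\<close>

datatype 'g valext = Val 'g | Infty

instantiation valext :: (linorder) linorder
begin

fun less_eq_valext :: "'a valext \<Rightarrow> 'a valext \<Rightarrow> bool" where
  "less_eq_valext x Infty \<longleftrightarrow> True"
| "less_eq_valext Infty (Val b) \<longleftrightarrow> False"
| "less_eq_valext (Val a) (Val b) \<longleftrightarrow> a \<le> b"

definition less_valext :: "'a valext \<Rightarrow> 'a valext \<Rightarrow> bool" where
  "less_valext x y \<longleftrightarrow> x \<le> y \<and> \<not> y \<le> x"

instance
proof
  fix x y z :: "'a valext"
  show "x < y \<longleftrightarrow> x \<le> y \<and> \<not> y \<le> x" by (rule less_valext_def)
  show "x \<le> x" by (cases x) auto
  show "x \<le> y \<Longrightarrow> y \<le> z \<Longrightarrow> x \<le> z" by (cases x; cases y; cases z) auto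
  show "x \<le> y \<Longrightarrow> y \<le> x \<Longrightarrow> x = y" by (cases x; cases y) auto
  show "x \<le> y \<or> y \<le> x" by (cases x; cases y) auto
qed

end

lemma less_valext_simps [simp]:
  "\<not> Infty < (x :: 'g::linorder valext)"
  "Val a < Infty"
  "Val a < Val b \<longleftrightarrow> a < b"
  by (cases x; auto simp: less_valext_def not_le)+

instantiation valext :: (comm_monoid_add) comm_monoid_add
begin

definition zero_valext :: "'a valext" where "zero_valext = Val 0"

fun plus_valext :: "'a valext \<Rightarrow> 'a valext \<Rightarrow> 'a valext" where
  "plus_valext (Val a) (Val b) = Val (a + b)"
| "plus_valext Infty y = Infty"
| "plus_valext (Val a) Infty = Infty"

instance
proof
  fix x y z :: "'a valext"
  show "x + y + z = x + (y + z)" by (cases x; cases y; cases z) (auto simp: add.assoc)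
  show "x + y = y + x" by (cases x; cases y) (auto simp: add.commute)
  show "0 + x = x" by (cases x) (auto simp: zero_valext_def)
qed

end

locale krull_valuation =
  fixes v :: "'a::field \<Rightarrow> 'g::linordered_ab_group_add valext"
  assumes val_eq_Infty_iff: "v f = Infty \<longleftrightarrow> f = 0"
    and val_mult: "v (f * g) = v f + v g"
    and val_add: "min (v f) (v g) \<le> v (f + g)"
    and val_onto: "range v = UNIV"

definition valuation_ring :: "('a::field \<Rightarrow> 'g::linordered_ab_group_add valext) \<Rightarrow> 'a set" where
  "valuation_ring v = {f. 0 \<le> v f}"

definition maximal_ideal :: "('a::field \<Rightarrow> 'g::linordered_ab_group_add valext) \<Rightarrow> 'a set" where
  "maximal_ideal v = {f. 0 < v f}"

text \<open>The residue map sends \<open>f\<close> to the coset \<open>f + \<mm>\<close>; the residue field \<open>\<O>/\<mm>\<close> is the set of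
  cosets of elements of the valuation ring.\<close>

definition residue_map :: "('a::field \<Rightarrow> 'g::linordered_ab_group_add valext) \<Rightarrow> 'a \<Rightarrow> 'a set" where
  "residue_map v f = (\<lambda>m. f + m) ` maximal_ideal v"

definition residue_field :: "('a::field \<Rightarrow> 'g::linordered_ab_group_add valext) \<Rightarrow> 'a set set" where
  "residue_field v = residue_map v ` valuation_ring v"

locale subfield_of =
  fixes C :: "'a::field set"
  assumes zero_mem: "0 \<in> C"
    and one_mem: "1 \<in> C"
    and add_mem: "a \<in> C \<Longrightarrow> b \<in> C \<Longrightarrow> a + b \<in> C"
    and uminus_mem: "a \<in> C \<Longrightarrow> - a \<in> C"
    and mult_mem: "a \<in> C \<Longrightarrow> b \<in> C \<Longrightarrow> a * b \<in> C"
    and inverse_mem: "a \<in> C \<Longrightarrow> a \<noteq> 0 \<Longrightarrow> inverse a \<in> C"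

definition lift_of_residue_field ::
  "('a::field \<Rightarrow> 'g::linordered_ab_group_add valext) \<Rightarrow> 'a set \<Rightarrow> bool" where
  "lift_of_residue_field v C \<longleftrightarrow>
     subfield_of C \<and> C \<subseteq> valuation_ring v \<and> bij_betw (residue_map v) C (residue_field v)"

section \<open>Wellordered subsets\<close>

definition wellordered :: "'g::linorder set \<Rightarrow> bool" where
  "wellordered S \<longleftrightarrow> (\<forall>T. T \<subseteq> S \<and> T \<noteq> {} \<longrightarrow> (\<exists>m\<in>T. \<forall>x\<in>T. m \<le> x))"

lemma wellorderedD:
  assumes "wellordered S" "T \<subseteq> S" "T \<noteq> {}"
  obtains m where "m \<in> T" "\<And>x. x \<in> T \<Longrightarrow> m \<le> x"
  using assms unfolding wellordered_def by meson

lemma wellordered_subset: "wellordered S \<Longrightarrow> T \<subseteq> S \<Longrightarrow> wellordered T"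
  unfolding wellordered_def by (meson order_trans)

lemma wellordered_empty [simp]: "wellordered {}"
  by (auto simp: wellordered_def)

lemma wellordered_finite:
  assumes "finite S" shows "wellordered S"
  unfolding wellordered_def
proof (intro allI impI)
  fix T assume "T \<subseteq> S \<and> T \<noteq> {}"
  then have "finite T" "T \<noteq> {}" using assms finite_subset by auto
  then have "Min T \<in> T" "\<forall>x\<in>T. Min T \<le> x" by auto
  then show "\<exists>m\<in>T. \<forall>x\<in>T. m \<le> x" by blast
qed

lemma wellordered_Un:
  assumes "wellordered S" "wellordered T" shows "wellordered (S \<union> T)"
  unfolding wellordered_def
proof (intro allI impI)
  fix U assume U: "U \<subseteq> S \<union> T \<and> U \<noteq> {}"
  show "\<exists>m\<in>U. \<forall>x\<in>U. m \<le> x"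
  proof (cases "U \<inter> S = {} \<or> U \<inter> T = {}")
    case True
    then have "U \<subseteq> S \<or> U \<subseteq> T" using U by blast
    then show ?thesis using U assms unfolding wellordered_def by blast
  next
    case False
    obtain m where m: "m \<in> U \<inter> S" "\<And>x. x \<in> U \<inter> S \<Longrightarrow> m \<le> x"
      using wellorderedD[OF assms(1), of "U \<inter> S"] False by blast
    obtain n where n: "n \<in> U \<inter> T" "\<And>x. x \<in> U \<inter> T \<Longrightarrow> n \<le> x"
      using wellorderedD[OF assms(2), of "U \<inter> T"] False by blast
    have "\<forall>x\<in>U. min m n \<le> x" using U m n by (auto simp: min_le_iff_disj)
    moreover have "min m n \<in> U" using m n by (auto simp: min_def)
    ultimately show ?thesis by blast
  qed
qed

lemma wellordered_no_descent:
  assumes "wellordered S" "range s \<subseteq> S"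
  shows "\<exists>n. s n \<le> s (Suc n)"
proof -
  obtain m where "m \<in> range s" "\<And>x. x \<in> range s \<Longrightarrow> m \<le> x"
    using wellorderedD[OF assms] by blast
  then show ?thesis by auto
qed

lemma wellordered_incseq_subseq:
  fixes s :: "nat \<Rightarrow> 'g::linorder"
  assumes S: "wellordered S" "range s \<subseteq> S"
  shows "\<exists>f. strict_mono f \<and> incseq (\<lambda>n. s (f n))"
proof -
  obtain f :: "nat \<Rightarrow> nat" where f: "strict_mono f" "monoseq (\<lambda>n. s (f n))"
    using seq_monosub by blast
  consider "incseq (\<lambda>n. s (f n))" | "decseq (\<lambda>n. s (f n))"
    using f(2) monoseq_iff by blast
  then show ?thesis
  proof cases
    case 1
    then show ?thesis using f(1) by blast
  next
    case 2
    have "range (\<lambda>n. s (f n)) \<subseteq> S" using S(2) by auto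
    then obtain m where m: "m \<in> range (\<lambda>n. s (f n))" "\<And>x. x \<in> range (\<lambda>n. s (f n)) \<Longrightarrow> m \<le> x"
      using wellorderedD[OF S(1)] by blast
    then obtain k where k: "m = s (f k)" by blast
    have const: "s (f (n + k)) = m" for n
      using m(2) decseqD[OF 2, of k "n + k"] k by (intro antisym) auto
    have "strict_mono (\<lambda>n. f (n + k))" using f(1) by (auto simp: strict_mono_def)
    moreover have "incseq (\<lambda>n. s (f (n + k)))" by (simp add: const)
    ultimately show ?thesis by blast
  qed
qed

lemma wellordered_sums:
  fixes S T :: "'g::linordered_ab_group_add set"
  assumes S: "wellordered S" and T: "wellordered T"
  shows "wellordered {a + b |a b. a \<in> S \<and> b \<in> T}"
proof (rule ccontr)
  assume "\<not> ?thesis"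
  then obtain U where U: "U \<subseteq> {a + b |a b. a \<in> S \<and> b \<in> T}" "U \<noteq> {}"
    and desc: "\<And>x. x \<in> U \<Longrightarrow> \<exists>y\<in>U. y < x"
    unfolding wellordered_def by (meson not_le)
  have "\<exists>u. \<forall>n. u n \<in> U \<and> u (Suc n) < u n"
    by (rule dependent_nat_choice) (use U(2) desc in auto)
  then obtain u where u: "\<And>n. u n \<in> U" "\<And>n. u (Suc n) < u n" by blast
  have "\<forall>n. \<exists>a b. u n = a + b \<and> a \<in> S \<and> b \<in> T" using u(1) U(1) by blast
  then obtain a b where ab: "\<And>n. u n = a n + b n" "\<And>n. a n \<in> S" "\<And>n. b n \<in> T" by metis
  obtain f where f: "strict_mono f" "incseq (\<lambda>n. a (f n))"
    using wellordered_incseq_subseq[OF S, of a] ab(2) by blast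
  obtain n where n: "b (f n) \<le> b (f (Suc n))"
    using wellordered_no_descent[OF T, of "\<lambda>n. b (f n)"] ab(3) by blast
  have "a (f n) \<le> a (f (Suc n))" using incseqD[OF f(2), of n "Suc n"] by simp
  then have "u (f n) \<le> u (f (Suc n))" using n ab(1) by (simp add: add_mono)
  moreover have "f n < f (Suc n)" using f(1) by (simp add: strict_mono_Suc_iff)
  then have "u (f (Suc n)) < u (f n)" using lift_Suc_mono_less[of "\<lambda>n. - u n" "f n" "f (Suc n)"] u(2) by simp
  ultimately show False by simp
qed

lemma finite_if_min_max:
  fixes A :: "'g::linorder set"
  assumes wo: "wellordered A"
    and mx: "\<And>B. B \<subseteq> A \<Longrightarrow> B \<noteq> {} \<Longrightarrow> \<exists>m\<in>B. \<forall>x\<in>B. x \<le> m"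
  shows "finite A"
proof (rule ccontr)
  assume inf: "infinite A"
  define B where "B = {x \<in> A. finite {y \<in> A. y < x}}"
  have "A \<noteq> {}" using inf by auto
  then obtain m where "m \<in> A" "\<And>x. x \<in> A \<Longrightarrow> m \<le> x" using wellorderedD[OF wo, of A] by blast
  then have "{y \<in> A. y < m} = {}" by (auto simp: not_less)
  then have "m \<in> B" using \<open>m \<in> A\<close> by (simp only: B_def mem_Collect_eq) simp
  then obtain k where k: "k \<in> B" "\<forall>x\<in>B. x \<le> k" using mx[of B] unfolding B_def by blast
  have "{y \<in> A. y \<le> k} \<subseteq> insert k {y \<in> A. y < k}" by auto
  then have fin: "finite {y \<in> A. y \<le> k}" using k(1) finite_subset unfolding B_def by blast
  then have "A - {y \<in> A. y \<le> k} \<noteq> {}" using inf by (metis Diff_eq_empty_iff finite_subset)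
  then obtain n where n: "n \<in> A - {y \<in> A. y \<le> k}" "\<And>x. x \<in> A - {y \<in> A. y \<le> k} \<Longrightarrow> n \<le> x"
    using wellorderedD[OF wo, of "A - {y \<in> A. y \<le> k}"] by blast
  have "{y \<in> A. y < n} \<subseteq> {y \<in> A. y \<le> k}" using n(2) by force
  then have "n \<in> B" using n(1) fin finite_subset unfolding B_def by blast
  then show False using k(2) n(1) by auto
qed

lemma finite_sum_fibre:
  fixes S T :: "'g::linordered_ab_group_add set"
  assumes S: "wellordered S" and T: "wellordered T"
  shows "finite {(a, b). a + b = c \<and> a \<in> S \<and> b \<in> T}"
proof -
  define A where "A = {a \<in> S. c - a \<in> T}"
  have "finite A"
  proof (rule finite_if_min_max)
    show "wellordered A" using S by (rule wellordered_subset) (auto simp: A_def)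
    fix B assume B: "B \<subseteq> A" "B \<noteq> {}"
    obtain m where m: "m \<in> (\<lambda>a. c - a) ` B" "\<And>x. x \<in> (\<lambda>a. c - a) ` B \<Longrightarrow> m \<le> x"
      by (rule wellorderedD[OF T, of "(\<lambda>a. c - a) ` B"]) (use B in \<open>auto simp: A_def\<close>)
    then obtain k where "k \<in> B" "m = c - k" by blast
    moreover have "x \<le> k" if "x \<in> B" for x
      using m(2)[of "c - x"] that \<open>m = c - k\<close> by (auto simp: algebra_simps)
    ultimately show "\<exists>m\<in>B. \<forall>x\<in>B. x \<le> m" by blast
  qed
  moreover have "{(a, b). a + b = c \<and> a \<in> S \<and> b \<in> T} \<subseteq> (\<lambda>a. (a, c - a)) ` A"
    by (auto simp: A_def)
  ultimately show ?thesis by (meson finite_imageI finite_subset)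
qed

section \<open>Hahn series\<close>

typedef (overloaded) ('a::zero, 'g::linorder) hahn = "{f :: 'g \<Rightarrow> 'a. wellordered {\<gamma>. f \<gamma> \<noteq> 0}}"
  morphisms hcoeff Abs_hahn
  by (rule exI[of _ "\<lambda>_. 0"]) simp

setup_lifting type_definition_hahn

definition hsupp :: "('a::zero, 'g::linorder) hahn \<Rightarrow> 'g set" where
  "hsupp f = {\<gamma>. hcoeff f \<gamma> \<noteq> 0}"

lemma hahn_eqI: "(\<And>\<gamma>. hcoeff f \<gamma> = hcoeff g \<gamma>) \<Longrightarrow> f = g"
  by transfer auto

lemma wellordered_hsupp: "wellordered (hsupp f)"
  unfolding hsupp_def by transfer

definition hconv :: "('g::ab_group_add \<Rightarrow> 'a::comm_ring_1) \<Rightarrow> ('g \<Rightarrow> 'a) \<Rightarrow> 'g \<Rightarrow> 'a" where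
  "hconv f g \<gamma> = (\<Sum>(\<alpha>, \<beta>) \<in> {(\<alpha>, \<beta>). \<alpha> + \<beta> = \<gamma> \<and> f \<alpha> \<noteq> 0 \<and> g \<beta> \<noteq> 0}. f \<alpha> * g \<beta>)"

lemma hconv_nonzeroD:
  assumes "hconv f g \<gamma> \<noteq> 0"
  shows "\<gamma> \<in> {a + b |a b. a \<in> {\<gamma>. f \<gamma> \<noteq> 0} \<and> b \<in> {\<gamma>. g \<gamma> \<noteq> 0}}"
proof -
  have "{(\<alpha>, \<beta>). \<alpha> + \<beta> = \<gamma> \<and> f \<alpha> \<noteq> 0 \<and> g \<beta> \<noteq> 0} \<noteq> {}"
    using assms unfolding hconv_def by (metis sum.empty)
  then show ?thesis by blast
qed

lemma wellordered_hconv: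
  fixes f g :: "'g::linordered_ab_group_add \<Rightarrow> 'a::comm_ring_1"
  assumes "wellordered {\<gamma>. f \<gamma> \<noteq> 0}" "wellordered {\<gamma>. g \<gamma> \<noteq> 0}"
  shows "wellordered {\<gamma>. hconv f g \<gamma> \<noteq> 0}"
  by (rule wellordered_subset[OF wellordered_sums[OF assms]]) (use hconv_nonzeroD in blast)

text \<open>The convolution sum may be taken over any larger wellordered sets of exponents.\<close>

lemma hconv_superset:
  fixes f g :: "'g::linordered_ab_group_add \<Rightarrow> 'a::comm_ring_1"
  assumes "wellordered S" "wellordered T" "{\<gamma>. f \<gamma> \<noteq> 0} \<subseteq> S" "{\<gamma>. g \<gamma> \<noteq> 0} \<subseteq> T"
  shows "hconv f g \<gamma> = (\<Sum>(\<alpha>, \<beta>) \<in> {(\<alpha>, \<beta>). \<alpha> + \<beta> = \<gamma> \<and> \<alpha> \<in> S \<and> \<beta> \<in> T}. f \<alpha> * g \<beta>)"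
  unfolding hconv_def
  by (rule sum.mono_neutral_left[OF finite_sum_fibre[OF assms(1,2)]]) (use assms(3,4) in auto)

lemma hconv_commute: "hconv f g \<gamma> = hconv g f \<gamma>"
  unfolding hconv_def
  by (rule sum.reindex_bij_witness[of _ "\<lambda>(a, b). (b, a)" "\<lambda>(a, b). (b, a)"])
     (auto simp: add.commute mult.commute)

lemma hconv_assoc_triple:
  fixes f g h :: "'g::linordered_ab_group_add \<Rightarrow> 'a::comm_ring_1"
  assumes f: "wellordered {\<gamma>. f \<gamma> \<noteq> 0}" and g: "wellordered {\<gamma>. g \<gamma> \<noteq> 0}"
    and h: "wellordered {\<gamma>. h \<gamma> \<noteq> 0}"
  shows "hconv (hconv f g) h \<gamma> =
    (\<Sum>(a, b, c) \<in> {(a, b, c). a + b + c = \<gamma> \<and> f a \<noteq> 0 \<and> g b \<noteq> 0 \<and> h c \<noteq> 0}. f a * g b * h c)"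
proof -
  define W where "W = {a + b |a b. a \<in> {\<gamma>. f \<gamma> \<noteq> 0} \<and> b \<in> {\<gamma>. g \<gamma> \<noteq> 0}}"
  define P where "P x = {(\<alpha>, \<beta>). \<alpha> + \<beta> = x \<and> f \<alpha> \<noteq> 0 \<and> g \<beta> \<noteq> 0}" for x
  define X where "X = {(x, c). x + c = \<gamma> \<and> x \<in> W \<and> c \<in> {\<gamma>. h \<gamma> \<noteq> 0}}"
  have W: "wellordered W" unfolding W_def by (rule wellordered_sums[OF f g])
  have finX: "finite X" unfolding X_def by (rule finite_sum_fibre[OF W h])
  have finP: "finite (P x)" for x
    unfolding P_def using finite_sum_fibre[OF f g, of x] by simp
  have "hconv (hconv f g) h \<gamma> = (\<Sum>(x, c) \<in> X. hconv f g x * h c)"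
    unfolding X_def by (rule hconv_superset[OF W h]) (use hconv_nonzeroD in \<open>auto simp: W_def\<close>)
  also have "\<dots> = (\<Sum>p \<in> X. \<Sum>q \<in> P (fst p). f (fst q) * g (snd q) * h (snd p))"
    unfolding hconv_def P_def by (simp add: case_prod_unfold sum_distrib_right)
  also have "\<dots> = (\<Sum>(p, q) \<in> Sigma X (\<lambda>p. P (fst p)). f (fst q) * g (snd q) * h (snd p))"
    by (rule sum.Sigma) (use finX finP in auto)
  also have "\<dots> = (\<Sum>(a, b, c) \<in> {(a, b, c). a + b + c = \<gamma> \<and> f a \<noteq> 0 \<and> g b \<noteq> 0 \<and> h c \<noteq> 0}.
      f a * g b * h c)"
    by (rule sum.reindex_bij_witness[of _ "\<lambda>(a, b, c). ((a + b, c), (a, b))"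
          "\<lambda>(p, q). (fst q, snd q, snd p)"])
       (auto simp: X_def P_def W_def)
  finally show ?thesis .
qed

lemma hconv_assoc:
  fixes f g h :: "'g::linordered_ab_group_add \<Rightarrow> 'a::comm_ring_1"
  assumes f: "wellordered {\<gamma>. f \<gamma> \<noteq> 0}" and g: "wellordered {\<gamma>. g \<gamma> \<noteq> 0}"
    and h: "wellordered {\<gamma>. h \<gamma> \<noteq> 0}"
  shows "hconv (hconv f g) h \<gamma> = hconv f (hconv g h) \<gamma>"
proof -
  have "hconv f (hconv g h) \<gamma> = hconv (hconv g h) f \<gamma>" by (rule hconv_commute)
  also have "\<dots> = (\<Sum>(a, b, c) \<in> {(a, b, c). a + b + c = \<gamma> \<and> g a \<noteq> 0 \<and> h b \<noteq> 0 \<and> f c \<noteq> 0}.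
      g a * h b * f c)"
    by (rule hconv_assoc_triple[OF g h f])
  also have "\<dots> = (\<Sum>(a, b, c) \<in> {(a, b, c). a + b + c = \<gamma> \<and> f a \<noteq> 0 \<and> g b \<noteq> 0 \<and> h c \<noteq> 0}.
      f a * g b * h c)"
    by (rule sum.reindex_bij_witness[of _ "\<lambda>(a, b, c). (b, c, a)" "\<lambda>(a, b, c). (c, a, b)"])
       (auto simp: algebra_simps)
  also have "\<dots> = hconv (hconv f g) h \<gamma>" by (rule hconv_assoc_triple[OF f g h, symmetric])
  finally show ?thesis ..
qed

instantiation hahn :: (comm_ring_1, linordered_ab_group_add) comm_ring_1
begin

lift_definition zero_hahn :: "('a, 'b) hahn" is "\<lambda>_. 0" by simp

lift_definition one_hahn :: "('a, 'b) hahn" is "\<lambda>\<gamma>. if \<gamma> = 0 then 1 else 0"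
  by (rule wellordered_finite) simp

lift_definition plus_hahn :: "('a, 'b) hahn \<Rightarrow> ('a, 'b) hahn \<Rightarrow> ('a, 'b) hahn"
  is "\<lambda>f g \<gamma>. f \<gamma> + g \<gamma>"
  by (rule wellordered_subset[OF wellordered_Un], assumption, assumption) auto

lift_definition uminus_hahn :: "('a, 'b) hahn \<Rightarrow> ('a, 'b) hahn" is "\<lambda>f \<gamma>. - f \<gamma>" by simp

lift_definition minus_hahn :: "('a, 'b) hahn \<Rightarrow> ('a, 'b) hahn \<Rightarrow> ('a, 'b) hahn"
  is "\<lambda>f g \<gamma>. f \<gamma> - g \<gamma>"
  by (rule wellordered_subset[OF wellordered_Un], assumption, assumption) auto

lift_definition times_hahn :: "('a, 'b) hahn \<Rightarrow> ('a, 'b) hahn \<Rightarrow> ('a, 'b) hahn" is hconv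
  by (rule wellordered_hconv)

instance
proof
  fix f g h :: "('a, 'b) hahn"
  show "f * g * h = f * (g * h)" by transfer (rule ext, rule hconv_assoc)
  show "f * g = g * f" by transfer (rule ext, rule hconv_commute)
  show "1 * f = f"
  proof (transfer, rule ext)
    fix f :: "'b \<Rightarrow> 'a" and \<gamma>
    have "{(\<alpha>, \<beta>). \<alpha> + \<beta> = \<gamma> \<and> (if \<alpha> = 0 then 1 else 0 :: 'a) \<noteq> 0 \<and> f \<beta> \<noteq> 0} =
        (if f \<gamma> = 0 then {} else {(0, \<gamma>)})"
      by (auto split: if_splits)
    then show "hconv (\<lambda>\<gamma>. if \<gamma> = 0 then 1 else 0) f \<gamma> = f \<gamma>"
      unfolding hconv_def by simp
  qed
  show "f + g + h = f + (g + h)" by transfer (simp add: add.assoc)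
  show "f + g = g + f" by transfer (simp add: add.commute)
  show "0 + f = f" by transfer simp
  show "- f + f = 0" by transfer simp
  show "f - g = f + - g" by transfer simp
  show "(0 :: ('a, 'b) hahn) \<noteq> 1" by transfer (metis zero_neq_one)
  show "(f + g) * h = f * h + g * h"
  proof (transfer, rule ext)
    fix f g h :: "'b \<Rightarrow> 'a" and \<gamma>
    assume wo: "wellordered {\<gamma>. f \<gamma> \<noteq> 0}" "wellordered {\<gamma>. g \<gamma> \<noteq> 0}" "wellordered {\<gamma>. h \<gamma> \<noteq> 0}"
    define S where "S = {\<gamma>. f \<gamma> \<noteq> 0} \<union> {\<gamma>. g \<gamma> \<noteq> 0}"
    have S: "wellordered S" unfolding S_def by (rule wellordered_Un[OF wo(1,2)])
    have "{\<gamma>. f \<gamma> + g \<gamma> \<noteq> 0} \<subseteq> S" "{\<gamma>. f \<gamma> \<noteq> 0} \<subseteq> S" "{\<gamma>. g \<gamma> \<noteq> 0} \<subseteq> S"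
      by (auto simp: S_def)
    then show "hconv (\<lambda>\<gamma>. f \<gamma> + g \<gamma>) h \<gamma> = hconv f h \<gamma> + hconv g h \<gamma>"
      by (simp add: hconv_superset[OF S wo(3) _ order_refl] distrib_right case_prod_unfold sum.distrib)
  qed
qed

end

lift_definition hmonom :: "'a::zero \<Rightarrow> 'g::linorder \<Rightarrow> ('a, 'g) hahn"
  is "\<lambda>c \<alpha> \<gamma>. if \<gamma> = \<alpha> then c else 0"
  by (rule wellordered_finite) simp

abbreviation hconst :: "'a::zero \<Rightarrow> ('a, 'g::linordered_ab_group_add) hahn" where
  "hconst c \<equiv> hmonom c 0"

abbreviation tpow :: "'g::linorder \<Rightarrow> ('a::zero_neq_one, 'g) hahn" where
  "tpow \<gamma> \<equiv> hmonom 1 \<gamma>"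

lift_definition htrunc :: "('a::zero, 'g::linorder) hahn \<Rightarrow> 'g \<Rightarrow> ('a, 'g) hahn"
  is "\<lambda>f \<alpha> \<gamma>. if \<gamma> < \<alpha> then f \<gamma> else 0"
  by (erule wellordered_subset) auto

definition hval :: "('a::comm_ring_1, 'g::linordered_ab_group_add) hahn \<Rightarrow> 'g valext" where
  "hval f = (if f = 0 then Infty else Val (LEAST \<gamma>. \<gamma> \<in> hsupp f))"

text \<open>\<open>C((t\<^sup>\<Gamma>))\<close> for a subfield \<open>C\<close> of the type \<open>'a\<close>, with the operations inherited from
  the ring of Hahn series over \<open>'a\<close>.\<close>

definition hahn_field :: "'a::field set \<Rightarrow> ('a, 'g::linordered_ab_group_add) hahn set" where
  "hahn_field C = {f. range (hcoeff f) \<subseteq> C}"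

definition truncation_closed :: "('a::zero, 'g::linorder) hahn set \<Rightarrow> bool" where
  "truncation_closed S \<longleftrightarrow> (\<forall>f\<in>S. \<forall>\<alpha>. htrunc f \<alpha> \<in> S)"

locale hahn_embedding =
  fixes v :: "'a::field \<Rightarrow> 'g::linordered_ab_group_add valext"
    and C :: "'a set"
    and e :: "'a \<Rightarrow> ('a, 'g) hahn"
  assumes emb_range: "range e \<subseteq> hahn_field C"
    and emb_inj: "inj e"
    and emb_one: "e 1 = 1"
    and emb_add: "e (f + g) = e f + e g"
    and emb_mult: "e (f * g) = e f * e g"
    and emb_const: "c \<in> C \<Longrightarrow> e c = hconst c"
    and emb_val: "hval (e f) = v f"

section \<open>Truncation structures\<close>

definition sp ::
  "('a::field \<Rightarrow> 'g::linordered_ab_group_add valext) \<Rightarrow> ('a \<Rightarrow> 'g \<Rightarrow> 'a) \<Rightarrow> 'a \<Rightarrow> 'g set" where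
  "sp v tr f = {\<gamma>. v (f - tr f \<gamma>) = Val \<gamma>}"

locale truncation_structure =
  fixes v :: "'a::field \<Rightarrow> 'g::linordered_ab_group_add valext"
    and C :: "'a set"
    and tr :: "'a \<Rightarrow> 'g \<Rightarrow> 'a"
    and \<tau> :: "'g \<Rightarrow> 'a"
  assumes tau_nonzero: "\<tau> \<gamma> \<noteq> 0"
    and T1: "v (f - tr f \<alpha>) \<ge> Val \<alpha>"
    and T2: "v f \<ge> Val \<alpha> \<Longrightarrow> tr f \<alpha> = 0"
    and T3: "\<beta> > \<alpha> \<Longrightarrow> tr (tr f \<alpha>) \<beta> = tr f \<alpha>"
    and T4_add: "tr (f + g) \<alpha> = tr f \<alpha> + tr g \<alpha>"
    and T4_scale: "c \<in> C \<Longrightarrow> tr (c * f) \<alpha> = c * tr f \<alpha>"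
    and T5: "wellordered (sp v tr f)"
    and T6: "\<forall>a \<in> sp v tr f. \<forall>b \<in> sp v tr g. a + b < \<gamma> \<Longrightarrow>
               \<forall>d \<in> sp v tr (f * g). d < \<gamma>"
    and T7: "\<tau> (\<alpha> + \<beta>) = \<tau> \<alpha> * \<tau> \<beta>"
    and T8: "sp v tr (\<tau> \<gamma>) = {\<gamma>}"

end

theory Submission
  imports Defs
begin

text \<open>
  Since \<open>v (\<tau> \<gamma>) = \<gamma>\<close>, axiom T1 provides a unique \<open>c \<in> C\<close> with
  \<open>v (f - f|\<^sub>\<gamma> - c \<tau>\<^sup>\<gamma>) > \<gamma>\<close>, and these \<open>c\<close> are the coefficients of \<open>e f\<close>; the support of
  \<open>e f\<close> is \<open>sp f\<close>. Any embedding inducing the truncation structure must have these coefficients.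

  The only difficulty is multiplicativity. Fix an exponent \<open>\<gamma>\<close>. If \<open>sp f + sp g < \<gamma>\<close>, then T6 says
  that the coefficients of \<open>e (f g)\<close> and \<open>e f e g\<close> at \<open>\<gamma>\<close> both vanish; if \<open>v f + v g \<ge> \<gamma>\<close>, both are
  determined by the leading terms. In general let \<open>\<alpha>\<close> be least in \<open>sp f\<close> such that \<open>\<alpha> + b \<ge> \<gamma>\<close> for
  some \<open>b \<in> sp g\<close>, and split \<open>f\<close> at \<open>\<alpha>\<close> and \<open>g\<close> at \<open>\<gamma> - \<alpha>\<close>. Only the product of the upper part of
  \<open>f\<close> with the lower part of \<open>g\<close> is not of these two kinds, and \<open>b\<close> is lost from \<open>sp g\<close>, so that the
  process stops by wellorderedness.
\<close>

section \<open>Coefficients and values of Hahn series\<close>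

lemma hcoeff_simps [simp]:
  "hcoeff 0 \<gamma> = 0"
  "hcoeff (f + g) \<gamma> = hcoeff f \<gamma> + hcoeff g \<gamma>"
  "hcoeff (f - g) \<gamma> = hcoeff f \<gamma> - hcoeff g \<gamma>"
  "hcoeff (hmonom c \<alpha>) \<gamma> = (if \<gamma> = \<alpha> then c else 0)"
  "hcoeff (htrunc f \<alpha>) \<gamma> = (if \<gamma> < \<alpha> then hcoeff f \<gamma> else 0)"
  by (transfer, simp)+

lemma one_hahn_eq: "1 = tpow 0"
  by transfer auto

lemma hcoeff_mult_nonzeroD:
  assumes "hcoeff (f * g) \<gamma> \<noteq> 0"
  obtains \<alpha> \<beta> where "\<gamma> = \<alpha> + \<beta>" "hcoeff f \<alpha> \<noteq> 0" "hcoeff g \<beta> \<noteq> 0"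
  using hconv_nonzeroD[of "hcoeff f" "hcoeff g" \<gamma>] assms by (auto simp: times_hahn.rep_eq)

text \<open>Exponents \<open>a >= \<alpha>\<close> and \<open>b >= \<beta>\<close> with
  \<open>a + b = \<alpha> + \<beta>\<close> must equal \<alpha> and \<beta>, so the convolution has
  at most one term.\<close>

lemma hcoeff_mult_leading:
  fixes f g :: "('a::comm_ring_1, 'g::linordered_ab_group_add) hahn"
  assumes f: "\<And>a. a < \<alpha> \<Longrightarrow> hcoeff f a = 0" and g: "\<And>b. b < \<beta> \<Longrightarrow> hcoeff g b = 0"
  shows "hcoeff (f * g) (\<alpha> + \<beta>) = hcoeff f \<alpha> * hcoeff g \<beta>"
proof -
  have "{(a, b). a + b = \<alpha> + \<beta> \<and> hcoeff f a \<noteq> 0 \<and> hcoeff g b \<noteq> 0} =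
      (if hcoeff f \<alpha> \<noteq> 0 \<and> hcoeff g \<beta> \<noteq> 0 then {(\<alpha>, \<beta>)} else {})"
  proof -
    have "a = \<alpha> \<and> b = \<beta>" if "a + b = \<alpha> + \<beta>" "hcoeff f a \<noteq> 0" "hcoeff g b \<noteq> 0" for a b
    proof -
      have "\<alpha> \<le> a" "\<beta> \<le> b" using f[of a] g[of b] that by (auto simp: not_less[symmetric])
      then show ?thesis
        using that(1) by (metis add_le_less_mono add_less_le_mono order_le_less order_less_irrefl)
    qed
    then show ?thesis by auto
  qed
  then show ?thesis by (auto simp: times_hahn.rep_eq hconv_def)
qed

lemma hmonom_mult: "hmonom a \<alpha> * hmonom b \<beta> = hmonom (a * b) (\<alpha> + \<beta>)"
proof (rule hahn_eqI)
  fix \<gamma>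
  show "hcoeff (hmonom a \<alpha> * hmonom b \<beta>) \<gamma> = hcoeff (hmonom (a * b) (\<alpha> + \<beta>)) \<gamma>"
  proof (cases "\<gamma> = \<alpha> + \<beta>")
    case True
    have "hcoeff (hmonom a \<alpha> * hmonom b \<beta>) (\<alpha> + \<beta>) = hcoeff (hmonom a \<alpha>) \<alpha> * hcoeff (hmonom b \<beta>) \<beta>"
      by (rule hcoeff_mult_leading) auto
    with True show ?thesis by simp
  next
    case False
    have "hcoeff (hmonom a \<alpha> * hmonom b \<beta>) \<gamma> = 0"
    proof (rule ccontr)
      assume "hcoeff (hmonom a \<alpha> * hmonom b \<beta>) \<gamma> \<noteq> 0"
      then obtain x y where "\<gamma> = x + y" "hcoeff (hmonom a \<alpha>) x \<noteq> 0" "hcoeff (hmonom b \<beta>) y \<noteq> 0"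
        by (rule hcoeff_mult_nonzeroD)
      with False show False by (simp split: if_splits)
    qed
    with False show ?thesis by simp
  qed
qed

lemma hcoeff_nonzero_ex:
  assumes "f \<noteq> 0"
  obtains \<gamma> where "hcoeff f \<gamma> \<noteq> 0" "\<And>\<beta>. \<beta> < \<gamma> \<Longrightarrow> hcoeff f \<beta> = 0"
proof -
  have "hsupp f \<noteq> {}" using assms hahn_eqI[of f 0] by (auto simp: hsupp_def)
  then obtain m where "m \<in> hsupp f" "\<And>x. x \<in> hsupp f \<Longrightarrow> m \<le> x"
    using wellorderedD[OF wellordered_hsupp[of f], of "hsupp f"] by blast
  then show ?thesis using that[of m] by (force simp: hsupp_def)
qed

lemma hval_eqI:
  assumes "hcoeff f \<gamma> \<noteq> 0" "\<And>\<beta>. \<beta> < \<gamma> \<Longrightarrow> hcoeff f \<beta> = 0"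
  shows "hval f = Val \<gamma>"
proof -
  have "(LEAST \<gamma>. \<gamma> \<in> hsupp f) = \<gamma>"
    by (rule Least_equality) (use assms in \<open>auto simp: hsupp_def not_less[symmetric]\<close>)
  then show ?thesis using assms(1) by (auto simp: hval_def)
qed

lemma hval_greaterI:
  assumes "\<And>\<beta>. \<beta> \<le> \<gamma> \<Longrightarrow> hcoeff f \<beta> = 0"
  shows "Val \<gamma> < hval f"
proof (cases "f = 0")
  case False
  then obtain \<delta> where \<delta>: "hcoeff f \<delta> \<noteq> 0" "\<And>\<beta>. \<beta> < \<delta> \<Longrightarrow> hcoeff f \<beta> = 0"
    by (rule hcoeff_nonzero_ex) blast
  then show ?thesis using assms[of \<delta>] by (auto simp: hval_eqI not_less[symmetric])
qed (simp add: hval_def)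

section \<open>Krull valuations and residues\<close>

context krull_valuation
begin

lemma val_zero [simp]: "v 0 = Infty"
  by (simp add: val_eq_Infty_iff)

lemma val_one [simp]: "v 1 = Val 0"
proof (cases "v 1")
  case (Val a)
  then show ?thesis using val_mult[of 1 1] by simp
qed (simp add: val_eq_Infty_iff)

lemma val_uminus [simp]: "v (- f) = v f"
proof -
  have "v (- 1) = Val 0"
  proof (cases "v (- 1)")
    case (Val a)
    \<comment> \<open>An ordered group has no 2-torsion, so \<open>a + a = 0\<close> forces
      \<open>a = 0\<close>.\<close>
    then show ?thesis using val_mult[of "- 1" "- 1"] by simp
  qed (simp add: val_eq_Infty_iff)
  then show ?thesis
    using val_mult[of "- 1" f] by (simp flip: zero_valext_def)
qed

lemma val_add_greater: "x < v f \<Longrightarrow> x < v g \<Longrightarrow> x < v (f + g)"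
  using val_add[of f g] by (meson min_less_iff_conj order_less_le_trans)

lemma val_diff_greater: "x < v f \<Longrightarrow> x < v g \<Longrightarrow> x < v (f - g)"
  using val_add_greater[of x f "- g"] by simp

lemma val_mult_greater: "Val \<alpha> \<le> v f \<Longrightarrow> Val \<beta> < v g \<Longrightarrow> Val (\<alpha> + \<beta>) < v (f * g)"
  by (cases "v f"; cases "v g") (auto simp: val_mult add_le_less_mono)

lemma residue_map_eq_iff: "residue_map v f = residue_map v g \<longleftrightarrow> Val 0 < v (f - g)"
proof
  assume eq: "residue_map v f = residue_map v g"
  have "f \<in> residue_map v f"
    unfolding residue_map_def maximal_ideal_def by (rule image_eqI[of _ _ 0]) (simp_all add: zero_valext_def)
  then obtain m where "f = g + m" "0 < v m"
    unfolding eq unfolding residue_map_def maximal_ideal_def by blast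
  then show "Val 0 < v (f - g)" by (simp add: zero_valext_def)
next
  have sub: "residue_map v f \<subseteq> residue_map v g" if "Val 0 < v (f - g)" for f g
  proof
    fix x assume "x \<in> residue_map v f"
    then obtain m where m: "x = f + m" "Val 0 < v m"
      by (auto simp: residue_map_def maximal_ideal_def zero_valext_def)
    \<comment> \<open>Rewrite \<open>f + m\<close> as \<open>g + ((f - g) + m)\<close>; the bracket
      again has positive value.\<close>
    show "x \<in> residue_map v g"
      unfolding residue_map_def maximal_ideal_def
      by (rule image_eqI[of _ _ "(f - g) + m"])
         (use m that in \<open>auto simp: zero_valext_def intro: val_add_greater\<close>)
  qed
  assume "Val 0 < v (f - g)"
  then show "residue_map v f = residue_map v g"
    using sub[of f g] sub[of g f] val_uminus[of "f - g"] by auto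
qed

end

section \<open>Coefficients determined by a truncation structure\<close>

locale truncated_field =
  krull_valuation v + truncation_structure v C tr \<tau>
  for v :: "'a::field \<Rightarrow> 'g::linordered_ab_group_add valext"
    and C :: "'a set" and tr :: "'a \<Rightarrow> 'g \<Rightarrow> 'a" and \<tau> :: "'g \<Rightarrow> 'a" +
  assumes lift: "lift_of_residue_field v C"
begin

sublocale subfield_of C
  using lift by (simp add: lift_of_residue_field_def)

lemma diff_mem: "a \<in> C \<Longrightarrow> b \<in> C \<Longrightarrow> a - b \<in> C"
  using add_mem[of a "- b"] uminus_mem by simp

lemma val_const_nonneg: "c \<in> C \<Longrightarrow> Val 0 \<le> v c"
  using lift by (auto simp: lift_of_residue_field_def valuation_ring_def zero_valext_def)

text \<open>An element of positive value has the residue of 0, and the residue map is injective on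
  \<open>C\<close>.\<close>

lemma const_eq_zero: "c \<in> C \<Longrightarrow> Val 0 < v c \<Longrightarrow> c = 0"
  using lift residue_map_eq_iff[of c 0] zero_mem
  by (auto simp: lift_of_residue_field_def bij_betw_def dest: inj_onD)

lemma val_const: "c \<in> C \<Longrightarrow> c \<noteq> 0 \<Longrightarrow> v c = Val 0"
  using val_const_nonneg const_eq_zero by (metis order_le_less)

lemma lift_ex:
  assumes "Val 0 \<le> v f"
  obtains c where "c \<in> C" "Val 0 < v (f - c)"
proof -
  have "residue_map v f \<in> residue_map v ` C"
    using lift assms
    by (auto simp: lift_of_residue_field_def bij_betw_def residue_field_def valuation_ring_def
        zero_valext_def)
  then show ?thesis using that residue_map_eq_iff by blast
qed

text \<open>At level \<open>v f\<close> the truncation vanishes by \<open>T2\<close>, so the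
  remainder is \<open>f\<close> itself.\<close>

lemma val_in_sp: "v f = Val \<gamma> \<Longrightarrow> \<gamma> \<in> sp v tr f"
  using T2[of \<gamma> f] by (simp add: sp_def)

lemma val_tau [simp]: "v (\<tau> \<gamma>) = Val \<gamma>"
proof (cases "v (\<tau> \<gamma>)")
  case (Val a)
  then show ?thesis using val_in_sp[of "\<tau> \<gamma>" a] T8[of \<gamma>] by simp
qed (simp add: val_eq_Infty_iff tau_nonzero)

lemma tau_zero [simp]: "\<tau> 0 = 1"
  using T7[of 0 0] tau_nonzero[of 0] by simp

lemma tr_zero [simp]: "tr 0 \<gamma> = 0"
  by (rule T2) simp

lemma tr_diff: "tr (f - g) \<gamma> = tr f \<gamma> - tr g \<gamma>"
  using T4_add[of "f - g" g \<gamma>] by simp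

text \<open>\<open>T3\<close> covers only strictly larger levels. At level \<alpha> itself,
  \<open>T1\<close> and \<open>T2\<close> show that the remainder \<open>f - tr f \<alpha>\<close>
  truncates to 0.\<close>

lemma tr_tr_same: "tr (tr f \<alpha>) \<alpha> = tr f \<alpha>"
  using T2[OF T1[of \<alpha> f]] by (simp add: tr_diff)

text \<open>The description is legitimate by \<open>coef_ex\<close> and by
  \<open>coef_unique\<close> applied to \<open>f - tr f \<gamma>\<close>.\<close>

definition coef :: "'a \<Rightarrow> 'g \<Rightarrow> 'a" where
  "coef f \<gamma> = (THE c. c \<in> C \<and> Val \<gamma> < v (f - tr f \<gamma> - c * \<tau> \<gamma>))"

text \<open>Subtracting the two approximations shows that \<open>(d - c) * \<tau> \<gamma>\<close>
  has value above \<gamma>, so \<open>d - c\<close> is an element of \<open>C\<close> of positive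
  value.\<close>

lemma coef_unique:
  assumes "c \<in> C" "d \<in> C" "Val \<gamma> < v (f - c * \<tau> \<gamma>)" "Val \<gamma> < v (f - d * \<tau> \<gamma>)"
  shows "c = d"
proof -
  have "Val \<gamma> < v ((d - c) * \<tau> \<gamma>)"
    using val_diff_greater[OF assms(3,4)] by (simp add: algebra_simps)
  then have "Val 0 < v (d - c)" by (cases "v (d - c)") (auto simp: val_mult)
  then show ?thesis using const_eq_zero[of "d - c"] diff_mem assms by auto
qed

lemma coef_eqI:
  assumes "c \<in> C" "Val \<gamma> < v (f - tr f \<gamma> - c * \<tau> \<gamma>)"
  shows "coef f \<gamma> = c"
  unfolding coef_def
  by (rule the_equality) (use assms in \<open>auto intro: coef_unique[of _ _ _ "f - tr f \<gamma>"]\<close>)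

lemma coef_ex: "\<exists>c\<in>C. Val \<gamma> < v (f - tr f \<gamma> - c * \<tau> \<gamma>)"
proof -
  \<comment> \<open>Division by \<open>\<tau> \<gamma>\<close> moves the remainder into the
    valuation ring, where its residue has a representative in \<open>C\<close>.\<close>
  define r where "r = (f - tr f \<gamma>) / \<tau> \<gamma>"
  have r: "f - tr f \<gamma> = r * \<tau> \<gamma>" by (simp add: r_def tau_nonzero)
  have "Val 0 \<le> v r"
    using T1[of \<gamma> f] unfolding r by (cases "v r") (auto simp: val_mult)
  then obtain c where c: "c \<in> C" "Val 0 < v (r - c)" by (rule lift_ex)
  have "f - tr f \<gamma> - c * \<tau> \<gamma> = \<tau> \<gamma> * (r - c)" by (simp add: r algebra_simps)
  then have "Val \<gamma> < v (f - tr f \<gamma> - c * \<tau> \<gamma>)"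
    using val_mult_greater[of \<gamma> "\<tau> \<gamma>" 0 "r - c"] c(2) by simp
  with c(1) show ?thesis by blast
qed

lemma coef_mem: "coef f \<gamma> \<in> C"
  and coef_val: "Val \<gamma> < v (f - tr f \<gamma> - coef f \<gamma> * \<tau> \<gamma>)"
  using coef_ex[of \<gamma> f] coef_eqI[of _ \<gamma> f] by blast+

lemma coef_leading: "Val \<gamma> \<le> v f \<Longrightarrow> Val \<gamma> < v (f - coef f \<gamma> * \<tau> \<gamma>)"
  using coef_val[of \<gamma> f] T2[of \<gamma> f] by simp

lemma coef_add: "coef (f + g) \<gamma> = coef f \<gamma> + coef g \<gamma>"
  by (rule coef_eqI)
     (use val_add_greater[OF coef_val[of \<gamma> f] coef_val[of \<gamma> g]] in
       \<open>auto simp: T4_add algebra_simps coef_mem add_mem\<close>)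

lemma coef_diff: "coef (f - g) \<gamma> = coef f \<gamma> - coef g \<gamma>"
  using coef_add[of "f - g" g \<gamma>] by simp

lemma coef_scale:
  assumes "c \<in> C"
  shows "coef (c * f) \<gamma> = c * coef f \<gamma>"
  by (rule coef_eqI)
     (use val_mult_greater[OF val_const_nonneg[OF assms] coef_val[of \<gamma> f]] assms in
       \<open>auto simp: T4_scale algebra_simps coef_mem mult_mem\<close>)

text \<open>The remainder \<open>f - tr f \<gamma>\<close> agrees with
  \<open>coef f \<gamma> * \<tau> \<gamma>\<close> up to values above \<gamma>, and this product has
  value exactly \<gamma> unless the coefficient is 0.\<close>

lemma coef_nonzero_iff: "coef f \<gamma> \<noteq> 0 \<longleftrightarrow> \<gamma> \<in> sp v tr f"
proof
  assume "\<gamma> \<in> sp v tr f"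
  then show "coef f \<gamma> \<noteq> 0" using coef_val[of \<gamma> f] by (auto simp: sp_def)
next
  assume nz: "coef f \<gamma> \<noteq> 0"
  have "v (coef f \<gamma> * \<tau> \<gamma>) = Val \<gamma>" using val_const[OF coef_mem nz] by (simp add: val_mult)
  then have "\<not> Val \<gamma> < v (f - tr f \<gamma>)"
    using val_diff_greater[OF _ coef_val[of \<gamma> f], of "f - tr f \<gamma>"] by auto
  then show "\<gamma> \<in> sp v tr f" using T1[of \<gamma> f] by (auto simp: sp_def)
qed

lemma coef_zero_below:
  assumes "Val \<gamma> < v f"
  shows "coef f \<gamma> = 0"
  by (rule coef_eqI) (use assms T2[of \<gamma> f] zero_mem in auto)

text \<open>Below \<alpha> nothing changes, since \<open>f - tr f \<alpha>\<close> has value at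
  least \<alpha>. From \<alpha> on, \<open>tr f \<alpha>\<close> is its own truncation and leaves
  remainder 0.\<close>

lemma coef_tr: "coef (tr f \<alpha>) \<gamma> = (if \<gamma> < \<alpha> then coef f \<gamma> else 0)"
proof (cases "\<gamma> < \<alpha>")
  case True
  then have "Val \<gamma> < v (f - tr f \<alpha>)" using T1[of \<alpha> f] by (meson less_valext_simps(3) order_less_le_trans)
  from coef_zero_below[OF this] True show ?thesis by (simp add: coef_diff)
next
  case False
  then have "tr (tr f \<alpha>) \<gamma> = tr f \<alpha>" using T3[of \<alpha> \<gamma> f] tr_tr_same[of f \<alpha>] by (cases "\<gamma> = \<alpha>") auto
  then have "coef (tr f \<alpha>) \<gamma> = 0" by (intro coef_eqI) (auto simp: zero_mem)
  with False show ?thesis by simp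
qed

lemma coef_tau: "coef (\<tau> \<alpha>) \<gamma> = (if \<gamma> = \<alpha> then 1 else 0)"
proof (cases "\<gamma> = \<alpha>")
  case True
  then show ?thesis using coef_eqI[of 1 \<alpha> "\<tau> \<alpha>"] T2[of \<alpha> "\<tau> \<alpha>"] one_mem by simp
next
  case False
  then show ?thesis using coef_nonzero_iff[of "\<tau> \<alpha>" \<gamma>] T8[of \<alpha>] by auto
qed

text \<open>With \<open>c = coef f \<alpha>\<close> and \<open>d = coef g \<beta>\<close>, the
  difference \<open>f * g - c * d * \<tau> (\<alpha> + \<beta>)\<close> is the sum of
  \<open>c * \<tau> \<alpha> * (g - d * \<tau> \<beta>)\<close> and
  \<open>g * (f - c * \<tau> \<alpha>)\<close>, both of value above
  \<open>\<alpha> + \<beta>\<close>.\<close>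

lemma coef_mult_leading:
  assumes f: "Val \<alpha> \<le> v f" and g: "Val \<beta> \<le> v g"
  shows "coef (f * g) (\<alpha> + \<beta>) = coef f \<alpha> * coef g \<beta>"
proof (rule coef_eqI)
  show "coef f \<alpha> * coef g \<beta> \<in> C" by (intro mult_mem coef_mem)
  have "Val (\<alpha> + \<beta>) \<le> v (f * g)"
    using f g by (cases "v f"; cases "v g") (auto simp: val_mult add_mono)
  then have tr: "tr (f * g) (\<alpha> + \<beta>) = 0" by (rule T2)
  have "Val \<alpha> \<le> v (coef f \<alpha> * \<tau> \<alpha>)"
    using val_const_nonneg[OF coef_mem, of f \<alpha>] by (cases "v (coef f \<alpha>)") (auto simp: val_mult)
  then have 1: "Val (\<alpha> + \<beta>) < v (coef f \<alpha> * \<tau> \<alpha> * (g - coef g \<beta> * \<tau> \<beta>))"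
    by (rule val_mult_greater) (rule coef_leading[OF g])
  have 2: "Val (\<alpha> + \<beta>) < v (g * (f - coef f \<alpha> * \<tau> \<alpha>))"
    using val_mult_greater[OF g coef_leading[OF f]] by (simp add: add.commute)
  show "Val (\<alpha> + \<beta>) < v (f * g - tr (f * g) (\<alpha> + \<beta>) - coef f \<alpha> * coef g \<beta> * \<tau> (\<alpha> + \<beta>))"
    using val_add_greater[OF 1 2] by (simp add: tr T7 algebra_simps)
qed

section \<open>The additive embedding\<close>

definition emb :: "'a \<Rightarrow> ('a, 'g) hahn" where
  "emb f = Abs_hahn (coef f)"

text \<open>The support of \<open>coef f\<close> is \<open>sp v tr f\<close>, which is wellordered
  by \<open>T5\<close>.\<close>

lemma hcoeff_emb [simp]: "hcoeff (emb f) = coef f"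
  unfolding emb_def by (rule Abs_hahn_inverse) (simp add: coef_nonzero_iff T5)

lemma emb_plus: "emb (f + g) = emb f + emb g"
  by (rule hahn_eqI) (simp add: coef_add)

lemma hval_emb: "hval (emb f) = v f"
proof (cases "v f")
  case (Val \<gamma>)
  show ?thesis
    unfolding Val
  proof (rule hval_eqI)
    show "hcoeff (emb f) \<gamma> \<noteq> 0" using val_in_sp[OF Val] by (simp add: coef_nonzero_iff)
  qed (simp add: coef_zero_below Val)
next
  case Infty
  then have "f = 0" by (simp add: val_eq_Infty_iff)
  then have "emb f = 0" by (intro hahn_eqI) (simp add: coef_zero_below)
  then show ?thesis using Infty by (simp add: hval_def)
qed

section \<open>Multiplicativity at a fixed exponent\<close>

definition coef_multiplicative :: "'g \<Rightarrow> 'a \<Rightarrow> 'a \<Rightarrow> bool" where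
  "coef_multiplicative \<gamma> f g \<longleftrightarrow> coef (f * g) \<gamma> = hcoeff (emb f * emb g) \<gamma>"

text \<open>Both sides of the defining equation are additive in the left factor.\<close>

lemma coef_multiplicative_split_left:
  assumes "coef_multiplicative \<gamma> (tr f \<alpha>) g" "coef_multiplicative \<gamma> (f - tr f \<alpha>) g"
  shows "coef_multiplicative \<gamma> f g"
proof -
  have "emb f = emb (tr f \<alpha>) + emb (f - tr f \<alpha>)" by (simp flip: emb_plus)
  moreover have "f * g = tr f \<alpha> * g + (f - tr f \<alpha>) * g" by (simp add: algebra_simps)
  ultimately show ?thesis
    using assms by (simp add: coef_multiplicative_def coef_add distrib_right)
qed

lemma coef_multiplicative_split_right:
  assumes "coef_multiplicative \<gamma> f (tr g \<beta>)" "coef_multiplicative \<gamma> f (g - tr g \<beta>)"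
  shows "coef_multiplicative \<gamma> f g"
  using coef_multiplicative_split_left[of \<gamma> g \<beta> f] assms
  by (simp add: coef_multiplicative_def mult.commute)

lemma coef_multiplicative_below:
  assumes "\<And>a b. a \<in> sp v tr f \<Longrightarrow> b \<in> sp v tr g \<Longrightarrow> a + b < \<gamma>"
  shows "coef_multiplicative \<gamma> f g"
proof -
  have "\<gamma> \<notin> sp v tr (f * g)" using T6[of f g \<gamma>] assms by blast
  then have "coef (f * g) \<gamma> = 0" using coef_nonzero_iff by blast
  moreover have "hcoeff (emb f * emb g) \<gamma> = 0"
  proof (rule ccontr)
    assume "hcoeff (emb f * emb g) \<gamma> \<noteq> 0"
    then show False
      by (rule hcoeff_mult_nonzeroD) (use assms in \<open>force simp: coef_nonzero_iff\<close>)
  qed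
  ultimately show ?thesis by (simp add: coef_multiplicative_def)
qed

lemma coef_multiplicative_leading:
  assumes "Val \<alpha> \<le> v f" "Val \<beta> \<le> v g"
  shows "coef_multiplicative (\<alpha> + \<beta>) f g"
  unfolding coef_multiplicative_def coef_mult_leading[OF assms]
proof (subst hcoeff_mult_leading)
  show "hcoeff (emb f) a = 0" if "a < \<alpha>" for a
    using that assms(1) by (simp add: coef_zero_below order_less_le_trans[of "Val a" "Val \<alpha>"])
  show "hcoeff (emb g) b = 0" if "b < \<beta>" for b
    using that assms(2) by (simp add: coef_zero_below order_less_le_trans[of "Val b" "Val \<beta>"])
qed simp

lemma sp_tr: "sp v tr (tr f \<alpha>) = {\<gamma> \<in> sp v tr f. \<gamma> < \<alpha>}"
  by (auto simp: coef_nonzero_iff[symmetric] coef_tr split: if_splits)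

text \<open>Only the right factor is controlled: its support drops below an element of the old one.
  The left factor may be arbitrary, since termination rests on \<open>sp v tr g\<close>
  alone.\<close>

lemma coef_multiplicative_descent:
  assumes bad: "\<not> coef_multiplicative \<gamma> f g"
  shows "\<exists>b\<in>sp v tr g. \<exists>f' g'. \<not> coef_multiplicative \<gamma> f' g' \<and> sp v tr g' \<subseteq> {x \<in> sp v tr g. x < b}"
proof -
  define A where "A = {a \<in> sp v tr f. \<exists>b\<in>sp v tr g. \<gamma> \<le> a + b}"
  have "A \<noteq> {}" using coef_multiplicative_below[of f g \<gamma>] bad by (force simp: A_def not_less)
  then obtain \<alpha> where \<alpha>: "\<alpha> \<in> A" "\<And>x. x \<in> A \<Longrightarrow> \<alpha> \<le> x"
    using wellorderedD[OF T5[of f], of A] by (auto simp: A_def)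
  then obtain b where b: "b \<in> sp v tr g" "\<gamma> \<le> \<alpha> + b" by (auto simp: A_def)
  have "coef_multiplicative \<gamma> (tr f \<alpha>) g"
  proof (rule coef_multiplicative_below)
    \<comment> \<open>An element \<open>a < \<alpha>\<close> of \<open>sp v tr f\<close> lies
      outside \<open>A\<close> by minimality of \<alpha>.\<close>
    fix a b assume "a \<in> sp v tr (tr f \<alpha>)" "b \<in> sp v tr g"
    then show "a + b < \<gamma>" using \<alpha>(2)[of a] by (force simp: A_def sp_tr)
  qed
  then have bad_upper: "\<not> coef_multiplicative \<gamma> (f - tr f \<alpha>) g"
    using bad coef_multiplicative_split_left by blast
  \<comment> \<open>The two upper parts have values at least \<alpha> and
    \<open>\<gamma> - \<alpha>\<close>, which add up to \<gamma>.\<close>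
  have "coef_multiplicative \<gamma> (f - tr f \<alpha>) (g - tr g (\<gamma> - \<alpha>))"
    using coef_multiplicative_leading[OF T1[of \<alpha> f] T1[of "\<gamma> - \<alpha>" g]] by simp
  then have "\<not> coef_multiplicative \<gamma> (f - tr f \<alpha>) (tr g (\<gamma> - \<alpha>))"
    using bad_upper coef_multiplicative_split_right by blast
  moreover have "\<gamma> - \<alpha> \<le> b" using b(2) by (simp add: algebra_simps)
  then have "sp v tr (tr g (\<gamma> - \<alpha>)) \<subseteq> {x \<in> sp v tr g. x < b}" by (auto simp: sp_tr)
  ultimately show ?thesis using b(1) by blast
qed

lemma coef_multiplicative_all: "coef_multiplicative \<gamma> f g"
proof (rule ccontr)
  assume bad: "\<not> coef_multiplicative \<gamma> f g"
  \<comment> \<open>Instead of iterating the descent, take the least bound in \<open>sp g\<close>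
    below which the right factor of some bad pair is supported.\<close>
  define B where "B = {b \<in> sp v tr g. \<exists>f' g'. \<not> coef_multiplicative \<gamma> f' g' \<and>
      sp v tr g' \<subseteq> {x \<in> sp v tr g. x < b}}"
  have "B \<noteq> {}" using coef_multiplicative_descent[OF bad] by (auto simp: B_def)
  then obtain b where b: "b \<in> B" "\<And>x. x \<in> B \<Longrightarrow> b \<le> x"
    using wellorderedD[OF T5[of g], of B] by (auto simp: B_def)
  then obtain f' g' where "\<not> coef_multiplicative \<gamma> f' g'"
    and g': "sp v tr g' \<subseteq> {x \<in> sp v tr g. x < b}" by (auto simp: B_def)
  then obtain b' f'' g'' where b': "b' \<in> sp v tr g'" and "\<not> coef_multiplicative \<gamma> f'' g''"
    and "sp v tr g'' \<subseteq> {x \<in> sp v tr g'. x < b'}"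
    using coef_multiplicative_descent by metis
  \<comment> \<open>The support of \<open>g'\<close> lies in that of \<open>g\<close> and below
    \<open>b\<close>, so the new bound \<open>b'\<close> is admissible and smaller than
    \<open>b\<close>.\<close>
  then have "b' \<in> B" using g' by (auto simp: B_def)
  then show False using b(2)[of b'] b' g' by auto
qed

section \<open>Embedding properties and uniqueness\<close>

lemma emb_times: "emb (f * g) = emb f * emb g"
  by (rule hahn_eqI) (use coef_multiplicative_all in \<open>simp add: coef_multiplicative_def\<close>)

lemma emb_tau: "emb (\<tau> \<gamma>) = tpow \<gamma>"
  by (rule hahn_eqI) (simp add: coef_tau)

lemma emb_tr: "emb (tr f \<alpha>) = htrunc (emb f) \<alpha>"
  by (rule hahn_eqI) (simp add: coef_tr)

lemma hahn_embedding_emb: "hahn_embedding v C emb"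
proof
  show "range emb \<subseteq> hahn_field C" by (auto simp: hahn_field_def coef_mem)
  show "inj emb"
  proof (rule injI)
    fix f g assume "emb f = emb g"
    \<comment> \<open>Injectivity follows from preservation of values: only 0 has value
      \<open>Infty\<close>.\<close>
    then have "emb (f - g) = 0" by (intro hahn_eqI) (simp add: coef_diff, simp flip: hcoeff_emb)
    then have "v (f - g) = Infty" using hval_emb[of "f - g"] by (simp add: hval_def)
    then show "f = g" by (simp add: val_eq_Infty_iff)
  qed
  show "emb 1 = 1" using emb_tau[of 0] by (simp add: one_hahn_eq)
  show "emb c = hconst c" if "c \<in> C" for c
    using coef_scale[OF that, of 1] coef_tau[of 0] by (intro hahn_eqI) simp
qed (simp_all add: emb_plus emb_times hval_emb)

text \<open>Removing from \<open>e f\<close> its truncation at \<gamma> and its term at \<gamma>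
  leaves a series of value above \<gamma>. Pulled back along \<open>e\<close>, this is the property
  characterising \<open>coef f \<gamma>\<close>.\<close>

lemma embedding_unique:
  assumes "hahn_embedding v C e"
    and tau: "\<And>\<gamma>. e (\<tau> \<gamma>) = tpow \<gamma>"
    and trunc: "\<And>f \<alpha>. e (tr f \<alpha>) = htrunc (e f) \<alpha>"
  shows "e = emb"
proof (rule ext, rule hahn_eqI)
  interpret e: hahn_embedding v C e by fact
  have e_diff: "e (f - g) = e f - e g" for f g
    using e.emb_add[of "f - g" g] by simp
  fix f \<gamma>
  define c where "c = hcoeff (e f) \<gamma>"
  have c: "c \<in> C" using e.emb_range by (auto simp: c_def hahn_field_def)
  have "e (f - tr f \<gamma> - c * \<tau> \<gamma>) = e f - htrunc (e f) \<gamma> - hmonom c \<gamma>"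
    by (simp add: e_diff trunc e.emb_mult e.emb_const[OF c] tau hmonom_mult)
  then have "Val \<gamma> < hval (e (f - tr f \<gamma> - c * \<tau> \<gamma>))"
    by (intro hval_greaterI) (auto simp: c_def)
  then have "coef f \<gamma> = c" using c by (intro coef_eqI) (simp_all add: e.emb_val)
  then show "hcoeff (e f) \<gamma> = hcoeff (emb f) \<gamma>" by (simp add: c_def)
qed

end

theorem theorem1p1:
  fixes v :: "'a::field \<Rightarrow> 'g::linordered_ab_group_add valext"
    and C :: "'a set"
    and tr :: "'a \<Rightarrow> 'g \<Rightarrow> 'a"
    and \<tau> :: "'g \<Rightarrow> 'a"
  assumes "krull_valuation v"
    and "lift_of_residue_field v C"
    and "truncation_structure v C tr \<tau>"
  shows "\<exists>!e :: 'a \<Rightarrow> ('a, 'g) hahn.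
           hahn_embedding v C e \<and>
           (\<forall>\<gamma>. e (\<tau> \<gamma>) = tpow \<gamma>) \<and>
           truncation_closed (range e) \<and>
           (\<forall>f \<alpha>. e (tr f \<alpha>) = htrunc (e f) \<alpha>)"
proof -
  interpret truncated_field v C tr \<tau>
    using assms by (intro truncated_field.intro truncated_field_axioms.intro)
  \<comment> \<open>A truncation of \<open>emb f\<close> is the image of the corresponding
    truncation of \<open>f\<close>.\<close>
  have "truncation_closed (range emb)"
    by (auto simp: truncation_closed_def simp flip: emb_tr)
  then show ?thesis
    by (intro ex1I[of _ emb] conjI allI)
       (simp_all add: hahn_embedding_emb emb_tau emb_tr embedding_unique)
qed

end
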